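(* Let $\mathbb{F} \in \{\mathbb{R}, \mathbb{C}\}$, $k \in \mathbb{N}$, and let $\mathbb{A}$ be an arbitrary topological $\mathbb{F}$-algebra. Suppose further that $A_1, \ldots, A_k \in \mathbb{A}$ are such that $\mathrm{Alg}_{\mathbb{F}}(\{A_1, \ldots, A_k\})$ is finite-dimensional. Then there exist open sets $\mathcal{U}_i \subseteq \mathbb{A}$ with $A_i \in \mathcal{U}_i$ ($1 \leq i \leq k$) such that $$\dim \mathrm{Alg}_{\mathbb{F}}(\{X_1, \ldots, X_k\}) \geq \dim \mathrm{Alg}_{\mathbb{F}}(\{A_1, \ldots, A_k\})$$ whenever $X_i \in \mathcal{U}_i$ for all $1 \leq i \leq k$. In particular, if $(\mathbb{A}, \|\cdot\|)$ is an arbitrary normed $\mathbb{F}$-algebra (and $A_1,\dots,A_k\in\mathbb{A}$ are such that $\mathrm{Alg}_{\mathbb{F}}(\{A_1, \ldots, A_k\})$ is finite-dimensional), then there exists an $\varepsilon > 0$ such that $$\dim \mathrm{Alg}_{\mathbb{F}}(\{X_1, \ldots, X_k\}) \geq \dim \mathrm{Alg}_{\mathbb{F}}(\{A_1, \ldots, A_k\})$$ whenever $X_1,\dots,X_k\in\mathbb{A}$ satisfy $\max_{1 \leq i \leq k} \|X_i - A_i\| < \varepsilon$.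
   Context: An $\mathbb{F}$-algebra is a vector space $\mathbb{A}$ over $\mathbb{F}$ together with a multiplication given by an $\mathbb{F}$-bilinear map $\mathbb{A}\times\mathbb{A}\to\mathbb{A}$; it is not assumed to be associative, commutative or unital. A topological $\mathbb{F}$-algebra is an $\mathbb{F}$-algebra endowed with a Hausdorff topology for which addition, multiplication by scalars, and the multiplication of $\mathbb{A}$ are all continuous. A normed $\mathbb{F}$-algebra is an $\mathbb{F}$-algebra with a vector space norm that is submultiplicative, $\|xy\|\le\|x\|\,\|y\|$. $\mathrm{Alg}_{\mathbb{F}}(S)$ denotes the $\mathbb{F}$-subalgebra of $\mathbb{A}$ generated by $S$, i.e. the smallest linear subspace containing $S$ and closed under multiplication. Dimensions are over $\mathbb{F}$ and may be infinite. *)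

theory Defs
  imports "HOL-Analysis.Analysis" "HOL-Library.Extended_Nat"
begin

definition finite_dim :: "('f::field \<Rightarrow> 'a::ab_group_add \<Rightarrow> 'a) \<Rightarrow> 'a set \<Rightarrow> bool" where
  "finite_dim smul V \<longleftrightarrow> (\<exists>B\<subseteq>V. finite B \<and> V \<subseteq> module.span smul B)"

(* The library's dim takes values in nat and says nothing useful about
   infinite-dimensional subspaces; here these get dimension \<infinity>. *)
definition edim :: "('f::field \<Rightarrow> 'a::ab_group_add \<Rightarrow> 'a) \<Rightarrow> 'a set \<Rightarrow> enat" where
  "edim smul V = (if finite_dim smul V then enat (vector_space.dim smul V) else \<infinity>)"

(* The algebra is a whole type, with explicit scalar multiplication and product.
   Associativity, commutativity and a unit are not required. *)
locale nonassoc_algebra = vector_space smul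
  for smul :: "'f::field \<Rightarrow> 'a::ab_group_add \<Rightarrow> 'a" +
  fixes mult :: "'a \<Rightarrow> 'a \<Rightarrow> 'a"
  assumes linear_left: "Vector_Spaces.linear smul smul (\<lambda>x. mult x y)"
    and linear_right: "Vector_Spaces.linear smul smul (\<lambda>y. mult x y)"
begin

definition subalgebra :: "'a set \<Rightarrow> bool" where
  "subalgebra V \<longleftrightarrow> subspace V \<and> (\<forall>x\<in>V. \<forall>y\<in>V. mult x y \<in> V)"

definition Alg :: "'a set \<Rightarrow> 'a set" where
  "Alg S = subalgebra hull S"

end

locale topological_algebra = nonassoc_algebra smul mult
  for smul :: "'f::real_normed_field \<Rightarrow> 'a::ab_group_add \<Rightarrow> 'a"
    and mult :: "'a \<Rightarrow> 'a \<Rightarrow> 'a" +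
  fixes T :: "'a topology"
  assumes topspace_UNIV: "topspace T = UNIV"
    and Hausdorff: "Hausdorff_space T"
    and continuous_add: "continuous_map (prod_topology T T) T (\<lambda>(x, y). x + y)"
    and continuous_scale: "continuous_map (prod_topology euclidean T) T (\<lambda>(c, x). smul c x)"
    and continuous_mult: "continuous_map (prod_topology T T) T (\<lambda>(x, y). mult x y)"

locale normed_algebra = nonassoc_algebra smul mult
  for smul :: "'f::real_normed_field \<Rightarrow> 'a::ab_group_add \<Rightarrow> 'a"
    and mult :: "'a \<Rightarrow> 'a \<Rightarrow> 'a" +
  fixes nrm :: "'a \<Rightarrow> real"
  assumes nrm_nonneg: "0 \<le> nrm x"
    and nrm_eq_zero_iff: "nrm x = 0 \<longleftrightarrow> x = 0"
    and nrm_triangle: "nrm (x + y) \<le> nrm x + nrm y"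
    and nrm_scale: "nrm (smul c x) = norm c * nrm x"
    and nrm_mult: "nrm (mult x y) \<le> nrm x * nrm y"

end

theory Submission imports Defs begin

text \<open>
  The algebra generated by a family is spanned by the values of all nonassociative monomials in
  that family. Choose finitely many monomials whose values at \<open>A\<close> form a basis of
  \<open>Alg A\<close>. These values depend continuously on the family, and linear independence of
  finitely many vectors of a Hausdorff topological vector space is an open condition because the
  coefficient vectors can be normalized to range over a compact set. So the same monomials have
  independent values at every family close to \<open>A\<close>.
\<close>

section \<open>Monomials, independence of indexed families, dimension\<close>

text \<open>The free magma over \<open>'i\<close>. There is no constant for a unit, just as
  \<open>Alg\<close> adjoins none.\<close>

datatype 'i magma_term = Var 'i | Mul "'i magma_term" "'i magma_term"

text \<open>Indexed rather than set-based: distinct monomials may take equal values at some points,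
  and such a coincidence has to count as a dependence.\<close>

definition independent_family ::
  "('f::field \<Rightarrow> 'a::ab_group_add \<Rightarrow> 'a) \<Rightarrow> ('i \<Rightarrow> 'a) \<Rightarrow> 'i set \<Rightarrow> bool" where
  "independent_family smul v B \<longleftrightarrow>
    (\<forall>c. (\<Sum>b\<in>B. smul (c b) (v b)) = 0 \<longrightarrow> (\<forall>b\<in>B. c b = 0))"

context vector_space
begin

lemma independent_family_iff:
  assumes "finite B"
  shows "independent_family scale v B \<longleftrightarrow> inj_on v B \<and> independent (v ` B)"
proof
  assume ind: "independent_family scale v B"
  have inj: "inj_on v B"
  proof (rule inj_onI, rule ccontr)
    fix x y assume xy: "x \<in> B" "y \<in> B" "v x = v y" "x \<noteq> y"
    \<comment> \<open>A repeated vector gives the nontrivial relation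
      \<open>v x - v y = 0\<close>.\<close>
    define c where "c b = (if b = x then 1 else if b = y then - 1 else 0 :: 'a)" for b
    have "(\<Sum>b\<in>B. scale (c b) (v b)) = (\<Sum>b\<in>{x, y}. scale (c b) (v b))"
      using assms xy by (intro sum.mono_neutral_right) (auto simp: c_def)
    also have "\<dots> = 0"
      using xy by (simp add: c_def)
    finally have "c x = 0"
      using ind xy by (auto simp: independent_family_def)
    then show False
      by (simp add: c_def)
  qed
  moreover have "independent (v ` B)"
  proof
    assume "dependent (v ` B)"
    then obtain u where u: "(\<Sum>x\<in>v ` B. scale (u x) x) = 0" "\<exists>x\<in>v ` B. u x \<noteq> 0"
      using dependent_finite[of "v ` B"] assms by auto
    have "(\<Sum>b\<in>B. scale ((u \<circ> v) b) (v b)) = 0"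
      using u(1) by (simp add: sum.reindex[OF inj])
    then have "\<forall>b\<in>B. (u \<circ> v) b = 0"
      using ind unfolding independent_family_def by blast
    then show False
      using u(2) by auto
  qed
  ultimately show "inj_on v B \<and> independent (v ` B)" ..
next
  assume ind: "inj_on v B \<and> independent (v ` B)"
  show "independent_family scale v B"
    unfolding independent_family_def
  proof (intro allI impI)
    fix c assume c: "(\<Sum>b\<in>B. scale (c b) (v b)) = 0"
    have "(\<Sum>x\<in>v ` B. scale (c (inv_into B v x)) x) = 0"
      using c ind by (simp add: sum.reindex)
    moreover have "\<forall>u. (\<Sum>x\<in>v ` B. scale (u x) x) = 0 \<longrightarrow> (\<forall>x\<in>v ` B. u x = 0)"
      using ind assms dependent_finite[of "v ` B"] by blast
    ultimately have "\<forall>x\<in>v ` B. c (inv_into B v x) = 0"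
      by (elim allE impE)
    then show "\<forall>b\<in>B. c b = 0"
      using ind by auto
  qed
qed

text \<open>The exchange bound is used twice: a finite spanning set makes the basis \<open>D\<close>
  finite, and then \<open>D\<close> bounds \<open>S\<close>. In the other case the dimension is
  \<infinity>.\<close>

lemma edim_ge_card:
  assumes "independent S" "S \<subseteq> V"
  shows "enat (card S) \<le> edim scale V"
proof (cases "finite_dim scale V")
  case True
  then obtain C where C: "C \<subseteq> V" "finite C" "V \<subseteq> span C"
    by (auto simp: finite_dim_def)
  obtain D where D: "D \<subseteq> V" "independent D" "V \<subseteq> span D" "card D = dim V"
    by (rule basis_exists)
  have "finite D"
    using independent_span_bound[OF C(2) D(2)] C(3) D(1) by auto
  then have "card S \<le> card D"
    using independent_span_bound[OF _ assms(1)] assms(2) D(3) by blast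
  then show ?thesis
    using True D(4) by (simp add: edim_def)
qed (simp add: edim_def)

end

section \<open>Generated subalgebras as spans of monomials\<close>

context nonassoc_algebra
begin

primrec eval_term :: "('i \<Rightarrow> 'a) \<Rightarrow> 'i magma_term \<Rightarrow> 'a" where
  "eval_term X (Var i) = X i"
| "eval_term X (Mul s t) = mult (eval_term X s) (eval_term X t)"

lemma eval_term_cong: "(\<And>i. i \<in> set_magma_term t \<Longrightarrow> X i = Y i) \<Longrightarrow> eval_term X t = eval_term Y t"
  by (induction t) auto

text \<open>Linearity in one argument at a time: the left factor is extended from \<open>S\<close>
  to its span first, then the right factor.\<close>

lemma mult_span_closed:
  assumes "\<And>x y. x \<in> S \<Longrightarrow> y \<in> S \<Longrightarrow> mult x y \<in> span S"
    and x: "x \<in> span S" and y: "y \<in> span S"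
  shows "mult x y \<in> span S"
proof -
  interpret l: Vector_Spaces.linear smul smul "\<lambda>x. mult x y" for y
    by (rule linear_left)
  interpret r: Vector_Spaces.linear smul smul "mult x" for x
    by (rule linear_right)
  have sub_left: "subspace {u. mult u z \<in> span S}" for z
    by (simp add: subspace_def l.zero l.add l.scale span_zero span_add span_scale)
  have sub_right: "subspace {u. mult z u \<in> span S}" for z
    by (simp add: subspace_def r.zero r.add r.scale span_zero span_add span_scale)
  have left: "mult u z \<in> span S" if "u \<in> span S" "z \<in> S" for u z
    using span_induct[OF that(1) sub_left] assms(1) that(2) by auto
  show ?thesis
    using span_induct[OF y sub_right] left[OF x] by auto
qed

lemma subalgebra_Alg: "subalgebra (Alg S)"
  unfolding Alg_def by (rule hull_in) (auto simp: subalgebra_def intro: subspace_Inter)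

lemma eval_term_in_Alg:
  assumes "set_magma_term t \<subseteq> I"
  shows "eval_term X t \<in> Alg (X ` I)"
  using assms
proof (induction t)
  case (Var i)
  then show ?case
    by (simp add: Alg_def hull_inc)
next
  case (Mul s t)
  then show ?case
    using subalgebra_Alg by (simp add: subalgebra_def)
qed

text \<open>A product of two monomials is a monomial, so by bilinearity their span is already a
  subalgebra. For empty \<open>I\<close> there are no terms and both sides are the zero
  space.\<close>

lemma Alg_eq_span_eval_term:
  "Alg (X ` I) = span (eval_term X ` {t. set_magma_term t \<subseteq> I})"
proof
  let ?E = "eval_term X ` {t. set_magma_term t \<subseteq> I}"
  have "X ` I \<subseteq> ?E"
    by (force intro: image_eqI[where x = "Var _"])
  moreover have "mult x y \<in> span ?E" if xy: "x \<in> ?E" "y \<in> ?E" for x y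
  proof -
    obtain s t where "x = eval_term X s" "y = eval_term X t" "set_magma_term s \<subseteq> I" "set_magma_term t \<subseteq> I"
      using xy by auto
    then have "mult x y \<in> ?E"
      by (intro image_eqI[where x = "Mul s t"]) auto
    then show ?thesis
      by (rule span_base)
  qed
  then have "subalgebra (span ?E)"
    using mult_span_closed by (auto simp: subalgebra_def)
  ultimately show "Alg (X ` I) \<subseteq> span ?E"
    unfolding Alg_def by (meson hull_minimal span_superset subset_trans)
  show "span ?E \<subseteq> Alg (X ` I)"
    using subalgebra_Alg eval_term_in_Alg by (intro span_minimal) (auto simp: subalgebra_def)
qed

text \<open>The monomial values span, so a maximal independent set of them is a basis; finite
  dimension makes it finite.\<close>

lemma finite_dim_Alg_monomial_basis:
  assumes "finite_dim smul (Alg (X ` I))"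
  obtains B where "finite B" "\<And>t. t \<in> B \<Longrightarrow> set_magma_term t \<subseteq> I"
    "independent_family smul (eval_term X) B" "edim smul (Alg (X ` I)) = enat (card B)"
proof -
  let ?E = "eval_term X ` {t. set_magma_term t \<subseteq> I}"
  obtain C where C: "finite C" "Alg (X ` I) \<subseteq> span C"
    using assms by (auto simp: finite_dim_def)
  obtain D where D: "D \<subseteq> ?E" "independent D" "?E \<subseteq> span D"
    by (rule maximal_independent_subset)
  have DA: "D \<subseteq> Alg (X ` I)" "Alg (X ` I) \<subseteq> span D"
    using D span_superset[of ?E] span_minimal[OF D(3) subspace_span]
    by (auto simp: Alg_eq_span_eval_term)
  have "finite D"
    using independent_span_bound[OF C(1) D(2)] DA(1) C(2) by auto
  \<comment> \<open>One term is chosen for each basis vector, so that \<open>card B\<close> is the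
    dimension.\<close>
  obtain B where B: "B \<subseteq> {t. set_magma_term t \<subseteq> I}" "inj_on (eval_term X) B" "D = eval_term X ` B"
    using D(1) by (auto simp: subset_image_inj)
  have fin: "finite B"
    using B \<open>finite D\<close> finite_imageD by blast
  show thesis
  proof
    show "finite B"
      by (rule fin)
    show "set_magma_term t \<subseteq> I" if "t \<in> B" for t
      using B(1) that by blast
    show "independent_family smul (eval_term X) B"
      using B D fin by (simp add: independent_family_iff)
    have "dim (Alg (X ` I)) = card B"
      using dim_unique[OF DA D(2)] B by (simp add: card_image)
    then show "edim smul (Alg (X ` I)) = enat (card B)"
      using assms by (simp add: edim_def)
  qed
qed

end

section \<open>Continuity of linear combinations and monomials\<close>

context topological_algebra
begin

lemma continuous_map_add:
  assumes "continuous_map Z T f" "continuous_map Z T g"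
  shows "continuous_map Z T (\<lambda>z. f z + g z)"
  using continuous_map_compose[OF continuous_map_pairedI[OF assms] continuous_add]
  by (simp add: comp_def)

lemma continuous_map_scale:
  assumes "continuous_map Z euclidean f" "continuous_map Z T g"
  shows "continuous_map Z T (\<lambda>z. smul (f z) (g z))"
  using continuous_map_compose[OF continuous_map_pairedI[OF assms] continuous_scale]
  by (simp add: comp_def)

lemma continuous_map_mult:
  assumes "continuous_map Z T f" "continuous_map Z T g"
  shows "continuous_map Z T (\<lambda>z. mult (f z) (g z))"
  using continuous_map_compose[OF continuous_map_pairedI[OF assms] continuous_mult]
  by (simp add: comp_def)

lemma continuous_map_sum:
  assumes "\<And>b. b \<in> B \<Longrightarrow> continuous_map Z T (f b)"
  shows "continuous_map Z T (\<lambda>z. \<Sum>b\<in>B. f b z)"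
  using assms
\<comment> \<open>Over an infinite or empty \<open>B\<close> the sum is the constant
  \<open>0\<close>.\<close>
proof (induction B rule: infinite_finite_induct)
  case (insert b B)
  then show ?case
    by (simp add: continuous_map_add)
qed (simp_all add: topspace_UNIV)

text \<open>A variable is a coordinate projection of the product over \<open>I\<close>, which is
  where the bound on the variables of \<open>t\<close> enters; products preserve continuity.\<close>

lemma continuous_map_eval_term:
  assumes "set_magma_term t \<subseteq> I"
  shows "continuous_map (product_topology (\<lambda>_. T) I) T (\<lambda>X. eval_term X t)"
  using assms
proof (induction t)
  case (Var i)
  then show ?case
    using continuous_map_product_projection[of i I "\<lambda>_. T"] by simp
next
  case (Mul s t)
  then show ?case
    by (simp add: continuous_map_mult)
qed

end

section \<open>Linear independence is an open condition\<close>

text \<open>A dependent family has a relation with coefficients in one of finitely many compact sets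
  \<open>K a\<close>. Avoiding all relations from one compact set is open by the tube lemma.
  \<open>heine_borel\<close> makes the closed unit ball of scalars compact.\<close>

lemma openin_independent_family:
  fixes smul :: "'f::{real_normed_field, heine_borel} \<Rightarrow> 'a::ab_group_add \<Rightarrow> 'a"
    and mult :: "'a \<Rightarrow> 'a \<Rightarrow> 'a"
  assumes "topological_algebra smul mult T" and fin: "finite B"
  shows "openin (product_topology (\<lambda>_. T) B)
    {v \<in> topspace (product_topology (\<lambda>_. T) B). independent_family smul v B}"
proof -
  interpret topological_algebra smul mult T by fact
  let ?P = "product_topology (\<lambda>_. T) B"
  let ?Q = "product_topology (\<lambda>_. euclidean :: 'f topology) B"
  let ?F = "\<lambda>(c, v). \<Sum>b\<in>B. smul (c b) (v b)"
  \<comment> \<open>Dividing a nonzero coefficient vector by an entry of maximal norm puts it into one of these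
    compact sets.\<close>
  define K where "K a = (\<Pi>\<^sub>E b\<in>B. if b = a then {1} else cball (0::'f) 1)" for a
  have compact: "compactin ?Q (K a)" for a
    by (auto simp: K_def compactin_PiE)
  have cont: "continuous_map (prod_topology ?Q ?P) T ?F"
    unfolding case_prod_beta
  proof (intro continuous_map_sum continuous_map_scale)
    fix b assume b: "b \<in> B"
    show "continuous_map (prod_topology ?Q ?P) euclidean (\<lambda>p. fst p b)"
      using continuous_map_compose[OF continuous_map_fst continuous_map_product_projection[OF b]]
      by (simp add: o_def)
    show "continuous_map (prod_topology ?Q ?P) T (\<lambda>p. snd p b)"
      using continuous_map_compose[OF continuous_map_snd continuous_map_product_projection[OF b]]
      by (simp add: o_def)
  qed
  \<comment> \<open>\<open>W\<close> collects the pairs with nonzero combination; it is open because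
    points are closed in a Hausdorff space.\<close>
  define W where "W = {p \<in> topspace (prod_topology ?Q ?P). ?F p \<in> topspace T - {0}}"
  have W: "openin (prod_topology ?Q ?P) W"
    unfolding W_def
    by (intro openin_continuous_map_preimage[OF cont] open_in_Hausdorff_delete Hausdorff) simp
  have open_K: "openin ?P {v \<in> topspace ?P. \<forall>c\<in>K a. ?F (c, v) \<noteq> 0}" (is "openin _ ?O") for a
  proof (subst openin_subopen, intro ballI)
    fix v assume v: "v \<in> ?O"
    have Ktop: "K a \<subseteq> topspace ?Q"
      using compact compactin_subset_topspace by blast
    have "K a \<times> {v} \<subseteq> W"
      using v Ktop by (auto simp: W_def topspace_UNIV simp del: topspace_product_topology)
    moreover have "compactin ?P {v}"
      using v by simp
    \<comment> \<open>Tube lemma: the open set \<open>W\<close> contains the compact slice over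
      \<open>v\<close>, hence also the slices over a whole neighbourhood \<open>V\<close>.\<close>
    ultimately obtain U V where UV: "openin ?P V" "K a \<subseteq> U" "{v} \<subseteq> V" "U \<times> V \<subseteq> W"
      using Wallace_theorem_prod_topology[OF compact _ W] by metis
    have "V \<subseteq> ?O"
    proof
      fix w assume w: "w \<in> V"
      have "?F (c, w) \<noteq> 0" if "c \<in> K a" for c
      proof -
        have "(c, w) \<in> W"
          using UV(2,4) w that by blast
        then show ?thesis
          unfolding W_def by blast
      qed
      then show "w \<in> ?O"
        using openin_subset[OF UV(1)] w by blast
    qed
    then show "\<exists>V. openin ?P V \<and> v \<in> V \<and> V \<subseteq> ?O"
      using UV by auto
  qed
  have normalize: "\<exists>a\<in>B. \<exists>c\<in>K a. ?F (c, v) = 0" if dep: "\<not> independent_family smul v B" for v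
  proof -
    obtain c b where c: "?F (c, v) = 0" "b \<in> B" "c b \<noteq> 0"
      using dep by (auto simp: independent_family_def)
    obtain a where a: "a \<in> B" "\<And>b. b \<in> B \<Longrightarrow> norm (c b) \<le> norm (c a)"
    proof -
      have "Max ((norm \<circ> c) ` B) \<in> (norm \<circ> c) ` B"
        using fin c(2) by (intro Max_in) auto
      then obtain a where "a \<in> B" "Max ((norm \<circ> c) ` B) = norm (c a)"
        by auto
      then show thesis
        using fin that[of a] Max_ge[of "(norm \<circ> c) ` B"] by (metis comp_apply finite_imageI imageI)
    qed
    have ca: "c a \<noteq> 0"
      using a(2)[OF c(2)] c(3) by auto
    \<comment> \<open>The restriction to \<open>B\<close> makes \<open>d\<close> extensional, as
      membership in \<open>K a\<close> requires.\<close>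
    define d where "d = (\<lambda>b\<in>B. c b / c a)"
    have "d \<in> K a"
      using a ca by (auto simp: K_def d_def PiE_iff norm_divide divide_le_eq)
    moreover have "?F (d, v) = smul (inverse (c a)) (?F (c, v))"
      by (simp add: d_def scale_sum_right divide_inverse mult.commute)
    ultimately show ?thesis
      using a(1) c(1) by auto
  qed
  have "independent_family smul v B \<longleftrightarrow> (\<forall>a\<in>B. \<forall>c\<in>K a. ?F (c, v) \<noteq> 0)" for v
  proof
    assume ind: "independent_family smul v B"
    show "\<forall>a\<in>B. \<forall>c\<in>K a. ?F (c, v) \<noteq> 0"
    proof (intro ballI notI)
      fix a c assume ac: "a \<in> B" "c \<in> K a" "?F (c, v) = 0"
      then have "c a = 0"
        using ind by (auto simp: independent_family_def)
      \<comment> \<open>The entry pinned to \<open>1\<close> is what keeps every vector in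
        \<open>K a\<close> nontrivial.\<close>
      moreover have "c a = 1"
        using PiE_mem[OF ac(2)[unfolded K_def] ac(1)] by simp
      ultimately show False
        by simp
    qed
  qed (use normalize in blast)
  then have eq: "{v \<in> topspace ?P. independent_family smul v B} =
      topspace ?P \<inter> (\<Inter>a\<in>B. {v \<in> topspace ?P. \<forall>c\<in>K a. ?F (c, v) \<noteq> 0})"
    by auto
  show ?thesis
  \<comment> \<open>The empty family is always independent, so the set is the whole space;
    \<open>openin_INT2\<close> handles only nonempty intersections.\<close>
  proof (cases "B = {}")
    case True
    then show ?thesis
      by (simp add: independent_family_def flip: topspace_product_topology)
  next
    case False
    then show ?thesis
      unfolding eq by (intro openin_Int openin_topspace openin_INT2 fin open_K)
  qed
qed

section \<open>Semicontinuity of the dimension in a topological algebra\<close>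

theorem topological_algebra_edim_Alg_ge:
  fixes smul :: "'f::{real_normed_field, heine_borel} \<Rightarrow> 'a::ab_group_add \<Rightarrow> 'a"
    and mult :: "'a \<Rightarrow> 'a \<Rightarrow> 'a"
  assumes "topological_algebra smul mult T"
    and findim: "finite_dim smul (nonassoc_algebra.Alg smul mult (A ` I))"
  obtains U where "\<And>i. i \<in> I \<Longrightarrow> openin T (U i)" "\<And>i. i \<in> I \<Longrightarrow> A i \<in> U i"
    "\<And>X. (\<And>i. i \<in> I \<Longrightarrow> X i \<in> U i) \<Longrightarrow>
      edim smul (nonassoc_algebra.Alg smul mult (A ` I)) \<le>
      edim smul (nonassoc_algebra.Alg smul mult (X ` I))"
proof -
  interpret topological_algebra smul mult T by fact
  obtain B where B: "finite B" "\<And>t. t \<in> B \<Longrightarrow> set_magma_term t \<subseteq> I"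
    "independent_family smul (eval_term A) B" "edim smul (Alg (A ` I)) = enat (card B)"
    by (rule finite_dim_Alg_monomial_basis[OF findim]) blast
  let ?P = "product_topology (\<lambda>_. T) I"
  let ?R = "product_topology (\<lambda>_. T) B"
  let ?ev = "\<lambda>X. \<lambda>t\<in>B. eval_term X t"
  have "continuous_map ?P ?R ?ev"
    using continuous_map_eval_term[OF B(2)] by (subst continuous_map_componentwise) auto
  from openin_continuous_map_preimage[OF this openin_independent_family[OF assms(1) B(1)]]
  have opn: "openin ?P {X \<in> topspace ?P. ?ev X \<in> {v \<in> topspace ?R. independent_family smul v B}}"
    (is "openin _ ?O") .
  \<comment> \<open>Points of the product space are extensional on \<open>I\<close>. Restricting a
    family to \<open>I\<close> changes nothing, since the terms in \<open>B\<close> only use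
    variables from \<open>I\<close>.\<close>
  have ev_iff: "independent_family smul (?ev (restrict X I)) B \<longleftrightarrow> independent_family smul (eval_term X) B" for X
  proof -
    have "eval_term (restrict X I) t = eval_term X t" if "t \<in> B" for t
      using B(2)[OF that] by (intro eval_term_cong) auto
    then show ?thesis
      by (simp add: independent_family_def)
  qed
  have "restrict A I \<in> ?O"
    using B(3) by (simp add: ev_iff topspace_UNIV)
  \<comment> \<open>The sides of a basic open box around \<open>A\<close> are the required
    neighbourhoods.\<close>
  then have "\<exists>U. finite {i \<in> I. U i \<noteq> topspace T} \<and> (\<forall>i\<in>I. openin T (U i)) \<and>
      restrict A I \<in> Pi\<^sub>E I U \<and> Pi\<^sub>E I U \<subseteq> ?O"
    by (rule bspec[OF iffD1[OF openin_product_topology_alt opn]])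
  then obtain U where U: "\<forall>i\<in>I. openin T (U i)" "restrict A I \<in> Pi\<^sub>E I U" "Pi\<^sub>E I U \<subseteq> ?O"
    by (elim exE conjE) (rule that)
  show thesis
  proof
    show "A i \<in> U i" if "i \<in> I" for i
      using PiE_mem[OF U(2) that] that by simp
    fix X assume X: "\<And>i. i \<in> I \<Longrightarrow> X i \<in> U i"
    have "restrict X I \<in> Pi\<^sub>E I U"
      using X by auto
    then have "independent_family smul (eval_term X) B"
      using U(3) ev_iff[of X] by blast
    then have "inj_on (eval_term X) B" "independent (eval_term X ` B)"
      using independent_family_iff[OF B(1)] by blast+
    moreover have "eval_term X ` B \<subseteq> Alg (X ` I)"
      by (intro image_subsetI eval_term_in_Alg B(2))
    ultimately show "edim smul (Alg (A ` I)) \<le> edim smul (Alg (X ` I))"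
      using edim_ge_card B(4) by (metis card_image)
  qed (use U in auto)
qed

section \<open>Normed algebras as topological algebras\<close>

context normed_algebra
begin

lemma nrm_minus_commute: "nrm (x - y) = nrm (y - x)"
  using nrm_scale[of "- 1" "x - y"] by simp

lemma Metric_space_nrm: "Metric_space UNIV (\<lambda>x y. nrm (x - y))"
proof
  show "nrm (x - z) \<le> nrm (x - y) + nrm (y - z)" for x y z
    using nrm_triangle[of "x - y" "y - z"] by simp
qed (auto simp: nrm_nonneg nrm_eq_zero_iff nrm_minus_commute)

interpretation nrm: Metric_space UNIV "\<lambda>x y. nrm (x - y)"
  by (rule Metric_space_nrm)

text \<open>
  Gives continuity of both the scalar and the algebra product: \<open>f\<close> and \<open>g\<close> are the distances
  in the two arguments, \<open>a\<close> and \<open>b\<close> the norms at the base point.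
\<close>

lemma small_bilinear_estimate:
  fixes a b e :: real
  assumes "0 < e" "0 \<le> a" "0 \<le> b"
  obtains d where "0 < d"
    "\<And>f g. 0 \<le> f \<Longrightarrow> f < d \<Longrightarrow> 0 \<le> g \<Longrightarrow> g < d \<Longrightarrow> f * b + a * g + f * g < e"
proof
  \<comment> \<open>The bound \<open>1\<close> gives \<open>f * g \<le> d\<close>, for a total of
    \<open>d * (a + b + 1)\<close>; the \<open>2\<close> in the denominator makes the final
    inequality strict.\<close>
  define d where "d = min 1 (e / (a + b + 2))"
  show "0 < d"
    using assms by (simp add: d_def)
  fix f g assume fg: "0 \<le> f" "f < d" "0 \<le> g" "g < d"
  have "f * b + a * g + f * g \<le> d * b + a * d + d * 1"
    using fg assms by (intro add_mono mult_mono) (auto simp: d_def)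
  also have "\<dots> = d * (a + b + 1)"
    by (simp add: algebra_simps)
  also have "\<dots> < d * (a + b + 2)"
    using \<open>0 < d\<close> by simp
  also have "\<dots> \<le> e / (a + b + 2) * (a + b + 2)"
    using assms by (intro mult_right_mono) (auto simp: d_def)
  also have "\<dots> = e"
    using assms by simp
  finally show "f * b + a * g + f * g < e" .
qed

lemma nrm_triangle3: "nrm (x + y + z) \<le> nrm x + nrm y + nrm z"
  using nrm_triangle[of "x + y" z] nrm_triangle[of x y] by linarith

lemma topological_algebra_mtopology: "topological_algebra smul mult nrm.mtopology"
proof (unfold_locales)
  interpret l: Vector_Spaces.linear smul smul "\<lambda>x. mult x y" for y
    by (rule linear_left)
  interpret r: Vector_Spaces.linear smul smul "mult x" for x
    by (rule linear_right)
  show "topspace nrm.mtopology = UNIV" "Hausdorff_space nrm.mtopology"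
    by (simp_all add: nrm.Hausdorff_space_mtopology)
  show "continuous_map (prod_topology nrm.mtopology nrm.mtopology) nrm.mtopology (\<lambda>(x, y). x + y)"
    unfolding nrm.continuous_map_to_metric
  proof (clarsimp)
    fix x y and e :: real assume "0 < e"
    show "\<exists>U. openin (prod_topology nrm.mtopology nrm.mtopology) U \<and> (x, y) \<in> U \<and>
        (\<forall>p\<in>U. nrm (x + y - (case p of (x, y) \<Rightarrow> x + y)) < e)"
    proof (intro exI conjI ballI)
      show "openin (prod_topology nrm.mtopology nrm.mtopology)
          (nrm.mball x (e / 2) \<times> nrm.mball y (e / 2))"
        by (simp add: openin_prod_Times_iff)
      fix p assume "p \<in> nrm.mball x (e / 2) \<times> nrm.mball y (e / 2)"
      then obtain u v where p: "p = (u, v)" "nrm (x - u) < e / 2" "nrm (y - v) < e / 2"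
        by auto
      have "nrm (x + y - (u + v)) \<le> nrm (x - u) + nrm (y - v)"
        unfolding add_diff_add by (rule nrm_triangle)
      then show "nrm (x + y - (case p of (x, y) \<Rightarrow> x + y)) < e"
        using p by simp
    qed (use \<open>0 < e\<close> in \<open>auto simp: nrm_eq_zero_iff[THEN iffD2]\<close>)
  qed
  show "continuous_map (prod_topology nrm.mtopology nrm.mtopology) nrm.mtopology (\<lambda>(x, y). mult x y)"
    unfolding nrm.continuous_map_to_metric
  proof (clarsimp)
    fix x y and e :: real assume "0 < e"
    then obtain d where d: "0 < d" "\<And>f g. 0 \<le> f \<Longrightarrow> f < d \<Longrightarrow> 0 \<le> g \<Longrightarrow> g < d \<Longrightarrow>
        f * nrm y + nrm x * g + f * g < e"
      using small_bilinear_estimate nrm_nonneg by metis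
    show "\<exists>U. openin (prod_topology nrm.mtopology nrm.mtopology) U \<and> (x, y) \<in> U \<and>
        (\<forall>p\<in>U. nrm (mult x y - (case p of (x, y) \<Rightarrow> mult x y)) < e)"
    proof (intro exI conjI ballI)
      show "openin (prod_topology nrm.mtopology nrm.mtopology) (nrm.mball x d \<times> nrm.mball y d)"
        by (simp add: openin_prod_Times_iff)
      fix p assume "p \<in> nrm.mball x d \<times> nrm.mball y d"
      then obtain u v where p: "p = (u, v)" "nrm (u - x) < d" "nrm (v - y) < d"
        by (auto simp: nrm_minus_commute)
      \<comment> \<open>Expansion around the base point; the summands match those of the estimate,
        with \<open>f = nrm (u - x)\<close> and \<open>g = nrm (v - y)\<close>.\<close>
      have "mult u v - mult x y = mult (u - x) y + mult x (v - y) + mult (u - x) (v - y)"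
        by (simp add: l.diff r.diff)
      then have "nrm (mult u v - mult x y) \<le>
          nrm (mult (u - x) y) + nrm (mult x (v - y)) + nrm (mult (u - x) (v - y))"
        using nrm_triangle3 by metis
      also have "\<dots> \<le> nrm (u - x) * nrm y + nrm x * nrm (v - y) + nrm (u - x) * nrm (v - y)"
        by (intro add_mono nrm_mult)
      also have "\<dots> < e"
        using d p nrm_nonneg by simp
      finally show "nrm (mult x y - (case p of (x, y) \<Rightarrow> mult x y)) < e"
        by (simp add: p nrm_minus_commute)
    qed (use d in \<open>auto simp: nrm_eq_zero_iff[THEN iffD2]\<close>)
  qed
  show "continuous_map (prod_topology euclidean nrm.mtopology) nrm.mtopology (\<lambda>(c, x). smul c x)"
    unfolding nrm.continuous_map_to_metric
  proof (clarsimp)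
    fix c :: 'f and x :: 'a and e :: real assume "0 < e"
    then obtain d where d: "0 < d" "\<And>f g. 0 \<le> f \<Longrightarrow> f < d \<Longrightarrow> 0 \<le> g \<Longrightarrow> g < d \<Longrightarrow>
        f * nrm x + norm c * g + f * g < e"
      using small_bilinear_estimate nrm_nonneg norm_ge_zero by metis
    show "\<exists>U. openin (prod_topology euclidean nrm.mtopology) U \<and> (c, x) \<in> U \<and>
        (\<forall>p\<in>U. nrm (smul c x - (case p of (c, x) \<Rightarrow> smul c x)) < e)"
    proof (intro exI conjI ballI)
      show "openin (prod_topology euclidean nrm.mtopology) (ball c d \<times> nrm.mball x d)"
        by (simp add: openin_prod_Times_iff)
      fix p assume "p \<in> ball c d \<times> nrm.mball x d"
      then obtain u v where p: "p = (u, v)" "norm (u - c) < d" "nrm (v - x) < d"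
        by (auto simp: nrm_minus_commute dist_norm norm_minus_commute)
      \<comment> \<open>The same expansion, now with \<open>f = norm (u - c)\<close> and
        \<open>g = nrm (v - x)\<close>.\<close>
      have "smul u v - smul c x = smul (u - c) x + smul c (v - x) + smul (u - c) (v - x)"
        by (simp add: algebra_simps)
      then have "nrm (smul u v - smul c x) \<le>
          norm (u - c) * nrm x + norm c * nrm (v - x) + norm (u - c) * nrm (v - x)"
        using nrm_triangle3 nrm_scale by metis
      also have "\<dots> < e"
        using d p nrm_nonneg by simp
      finally show "nrm (smul c x - (case p of (c, x) \<Rightarrow> smul c x)) < e"
        by (simp add: p nrm_minus_commute)
    qed (use d in \<open>auto simp: nrm_eq_zero_iff[THEN iffD2]\<close>)
  qed
qed

lemma openin_mtopology_iff:
  "openin nrm.mtopology U \<longleftrightarrow> (\<forall>x\<in>U. \<exists>r>0. \<forall>y. nrm (y - x) < r \<longrightarrow> y \<in> U)"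
  by (auto simp: nrm.openin_mtopology subset_iff nrm_minus_commute)

end

text \<open>Each neighbourhood from the topological case contains a ball, and finitely many radii
  have a positive minimum.\<close>

theorem normed_algebra_edim_Alg_ge:
  fixes smul :: "'f::{real_normed_field, heine_borel} \<Rightarrow> 'a::ab_group_add \<Rightarrow> 'a"
    and mult :: "'a \<Rightarrow> 'a \<Rightarrow> 'a"
  assumes "normed_algebra smul mult nrm" and fin: "finite I"
    and findim: "finite_dim smul (nonassoc_algebra.Alg smul mult (A ` I))"
  obtains \<epsilon> where "0 < \<epsilon>"
    "\<And>X. (\<And>i. i \<in> I \<Longrightarrow> nrm (X i - A i) < \<epsilon>) \<Longrightarrow>
      edim smul (nonassoc_algebra.Alg smul mult (A ` I)) \<le>
      edim smul (nonassoc_algebra.Alg smul mult (X ` I))"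
proof -
  interpret normed_algebra smul mult nrm by fact
  obtain U where U: "\<And>i. i \<in> I \<Longrightarrow> openin (Metric_space.mtopology UNIV (\<lambda>x y. nrm (x - y))) (U i)"
    "\<And>i. i \<in> I \<Longrightarrow> A i \<in> U i"
    "\<And>X. (\<And>i. i \<in> I \<Longrightarrow> X i \<in> U i) \<Longrightarrow> edim smul (Alg (A ` I)) \<le> edim smul (Alg (X ` I))"
    by (rule topological_algebra_edim_Alg_ge[OF topological_algebra_mtopology findim]) blast
  have "\<forall>i\<in>I. \<exists>r>0. \<forall>y. nrm (y - A i) < r \<longrightarrow> y \<in> U i"
    using U(1,2) openin_mtopology_iff by blast
  then obtain r where r: "\<And>i. i \<in> I \<Longrightarrow> 0 < r i" "\<And>i y. i \<in> I \<Longrightarrow> nrm (y - A i) < r i \<Longrightarrow> y \<in> U i"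
    by metis
  show thesis
  proof
    \<comment> \<open>Inserting \<open>1\<close> keeps the set nonempty when \<open>I\<close> is
      empty.\<close>
    show "0 < Min (insert 1 (r ` I))"
      using fin r(1) by simp
    fix X assume "\<And>i. i \<in> I \<Longrightarrow> nrm (X i - A i) < Min (insert 1 (r ` I))"
    then show "edim smul (Alg (A ` I)) \<le> edim smul (Alg (X ` I))"
      using fin by (intro U(3) r(2)) auto
  qed
qed

section \<open>Quantified forms, and real and complex scalars\<close>

lemma topological_algebra_openin_family:
  fixes smul :: "'f::{real_normed_field, heine_borel} \<Rightarrow> 'a::ab_group_add \<Rightarrow> 'a"
    and mult :: "'a \<Rightarrow> 'a \<Rightarrow> 'a"
  assumes "topological_algebra smul mult T"
    and "finite_dim smul (nonassoc_algebra.Alg smul mult (A ` I))"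
  shows "\<exists>U. (\<forall>i\<in>I. openin T (U i) \<and> A i \<in> U i) \<and>
    (\<forall>X. (\<forall>i\<in>I. X i \<in> U i) \<longrightarrow>
      edim smul (nonassoc_algebra.Alg smul mult (X ` I)) \<ge>
      edim smul (nonassoc_algebra.Alg smul mult (A ` I)))"
proof -
  obtain U where "\<And>i. i \<in> I \<Longrightarrow> openin T (U i)" "\<And>i. i \<in> I \<Longrightarrow> A i \<in> U i"
    "\<And>X. (\<And>i. i \<in> I \<Longrightarrow> X i \<in> U i) \<Longrightarrow>
      edim smul (nonassoc_algebra.Alg smul mult (A ` I)) \<le>
      edim smul (nonassoc_algebra.Alg smul mult (X ` I))"
    by (rule topological_algebra_edim_Alg_ge[OF assms]) blast
  then show ?thesis
    by (intro exI[where x = U]) simp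
qed

text \<open>Every distance is at most the maximum. For empty \<open>I\<close> the value of
  \<open>Max\<close> is unspecified, but the pointwise bounds then hold vacuously.\<close>

lemma normed_algebra_Max_nrm:
  fixes smul :: "'f::{real_normed_field, heine_borel} \<Rightarrow> 'a::ab_group_add \<Rightarrow> 'a"
    and mult :: "'a \<Rightarrow> 'a \<Rightarrow> 'a"
  assumes "normed_algebra smul mult nrm" "finite I"
    and "finite_dim smul (nonassoc_algebra.Alg smul mult (A ` I))"
  shows "\<exists>\<epsilon>>0. \<forall>X. Max ((\<lambda>i. nrm (X i - A i)) ` I) < \<epsilon> \<longrightarrow>
    edim smul (nonassoc_algebra.Alg smul mult (X ` I)) \<ge>
    edim smul (nonassoc_algebra.Alg smul mult (A ` I))"
proof -
  obtain \<epsilon> where \<epsilon>: "0 < \<epsilon>" "\<And>X. (\<And>i. i \<in> I \<Longrightarrow> nrm (X i - A i) < \<epsilon>) \<Longrightarrow>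
      edim smul (nonassoc_algebra.Alg smul mult (A ` I)) \<le>
      edim smul (nonassoc_algebra.Alg smul mult (X ` I))"
    by (rule normed_algebra_edim_Alg_ge[OF assms]) blast
  have "nrm (X i - A i) < \<epsilon>" if "Max ((\<lambda>i. nrm (X i - A i)) ` I) < \<epsilon>" "i \<in> I" for X i
    by (rule le_less_trans[OF Max_ge that(1)]) (use that(2) assms(2) in auto)
  then show ?thesis
    using \<epsilon> by blast
qed

theorem theorem5p2:
  fixes k :: nat
  shows "(\<forall>(smul :: real \<Rightarrow> 'a::ab_group_add \<Rightarrow> 'a) (mult :: 'a \<Rightarrow> 'a \<Rightarrow> 'a) (T :: 'a topology) (A :: nat \<Rightarrow> 'a).
        topological_algebra smul mult T \<longrightarrow>
        finite_dim smul (nonassoc_algebra.Alg smul mult (A ` {1..k})) \<longrightarrow>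
        (\<exists>U :: nat \<Rightarrow> 'a set. (\<forall>i\<in>{1..k}. openin T (U i) \<and> A i \<in> U i) \<and>
          (\<forall>X :: nat \<Rightarrow> 'a. (\<forall>i\<in>{1..k}. X i \<in> U i) \<longrightarrow>
            edim smul (nonassoc_algebra.Alg smul mult (X ` {1..k})) \<ge>
            edim smul (nonassoc_algebra.Alg smul mult (A ` {1..k}))))) \<and>
     (\<forall>(smul :: real \<Rightarrow> 'a::ab_group_add \<Rightarrow> 'a) (mult :: 'a \<Rightarrow> 'a \<Rightarrow> 'a) (nrm :: 'a \<Rightarrow> real) (A :: nat \<Rightarrow> 'a).
        normed_algebra smul mult nrm \<longrightarrow>
        finite_dim smul (nonassoc_algebra.Alg smul mult (A ` {1..k})) \<longrightarrow>
        (\<exists>\<epsilon>>0. \<forall>X :: nat \<Rightarrow> 'a. Max ((\<lambda>i. nrm (X i - A i)) ` {1..k}) < \<epsilon> \<longrightarrow>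
            edim smul (nonassoc_algebra.Alg smul mult (X ` {1..k})) \<ge>
            edim smul (nonassoc_algebra.Alg smul mult (A ` {1..k})))) \<and>
     (\<forall>(smul :: complex \<Rightarrow> 'a::ab_group_add \<Rightarrow> 'a) (mult :: 'a \<Rightarrow> 'a \<Rightarrow> 'a) (T :: 'a topology) (A :: nat \<Rightarrow> 'a).
        topological_algebra smul mult T \<longrightarrow>
        finite_dim smul (nonassoc_algebra.Alg smul mult (A ` {1..k})) \<longrightarrow>
        (\<exists>U :: nat \<Rightarrow> 'a set. (\<forall>i\<in>{1..k}. openin T (U i) \<and> A i \<in> U i) \<and>
          (\<forall>X :: nat \<Rightarrow> 'a. (\<forall>i\<in>{1..k}. X i \<in> U i) \<longrightarrow>
            edim smul (nonassoc_algebra.Alg smul mult (X ` {1..k})) \<ge>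
            edim smul (nonassoc_algebra.Alg smul mult (A ` {1..k}))))) \<and>
     (\<forall>(smul :: complex \<Rightarrow> 'a::ab_group_add \<Rightarrow> 'a) (mult :: 'a \<Rightarrow> 'a \<Rightarrow> 'a) (nrm :: 'a \<Rightarrow> real) (A :: nat \<Rightarrow> 'a).
        normed_algebra smul mult nrm \<longrightarrow>
        finite_dim smul (nonassoc_algebra.Alg smul mult (A ` {1..k})) \<longrightarrow>
        (\<exists>\<epsilon>>0. \<forall>X :: nat \<Rightarrow> 'a. Max ((\<lambda>i. nrm (X i - A i)) ` {1..k}) < \<epsilon> \<longrightarrow>
            edim smul (nonassoc_algebra.Alg smul mult (X ` {1..k})) \<ge>
            edim smul (nonassoc_algebra.Alg smul mult (A ` {1..k}))))"
  \<comment> \<open>Both \<open>real\<close> and \<open>complex\<close> are normed fields with the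
    Heine-Borel property.\<close>
  by (intro conjI allI impI topological_algebra_openin_family normed_algebra_Max_nrm finite_atLeastAtMost)

end
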